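(* Let $A\in\mathbb{R}^{n\times n}$, $B\in\mathbb{R}^{n\times k}$ and $C\in\mathbb{R}^{k\times n}$. The following conditions are equivalent: (i) the system $Ax+B|Cx-d|=b$ has a unique solution $x\in\mathbb{R}^n$ for each $b\in\mathbb{R}^n$ and each $d\in\mathbb{R}^k$; (ii) the system $Ax+BD|Cx|=b$ has at least one solution $x\in\mathbb{R}^n$ for each $b\in\mathbb{R}^n$ and each $D\in\mathbb{R}^{k\times k}$ with $|D|=I_k$.
   Context: Absolute values of vectors and matrices are understood entrywise. $I_k$ is the $k\times k$ identity matrix; thus $|D|=I_k$ means that $D$ is a diagonal matrix with diagonal entries in $\{-1,1\}$. *)

theory Defs
  imports "HOL-Analysis.Analysis"
begin

(* The library's absolute value on vec is componentwise at every level of nesting, so on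
   real matrices it is the entrywise absolute value. *)

lemma abs_vec_entry: "\<bar>x\<bar> $ i = \<bar>x $ i\<bar>" for x :: "real ^ 'k"
  by (simp add: abs_vec_def)

lemma abs_matrix_entry: "\<bar>M\<bar> $ i $ j = \<bar>M $ i $ j\<bar>" for M :: "real ^ 'n ^ 'm"
  by (simp add: abs_vec_def)

end

theory Submission
  imports Defs
begin

text \<open>
  Both conditions are equivalent to a third one: the matrix \<open>A + B T C\<close> is nonsingular for every
  diagonal matrix \<open>T\<close> with diagonal entries in \<open>[-1, 1]\<close> (\<open>diagonal_regular\<close>).  The link is that the
  difference of two absolute values is \<open>\<bar>u\<bar> - \<bar>v\<bar> = T (u - v)\<close> for such a \<open>T\<close>, and conversely that
  every \<open>T\<close> and every value of \<open>u - v\<close> occur in this way.  Hence the differences of two solutions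
  of (i), for common \<open>b\<close> and \<open>d\<close>, are exactly the null vectors of the matrices \<open>A + B T C\<close>, and the
  third condition amounts to uniqueness in (i).

  Existence in (i) then comes for free, by topology.  The set of matrices \<open>T\<close> is compact, so the
  matrices \<open>A + B T C\<close> are bounded below by a common constant, and the continuous map
  \<open>x \<mapsto> A x + B \<bar>C x - d\<bar>\<close> expands distances up to a positive factor.  Its image is closed by this
  bound, open by invariance of domain, and therefore everything.

  If the third condition holds for \<open>B\<close>, it holds for \<open>B D\<close> whenever \<open>\<bar>D\<bar> = I\<close>, since \<open>D T\<close> again
  ranges over diagonal matrices with entries in \<open>[-1, 1]\<close>; this gives (ii).  Conversely, if some
  \<open>A + B T C\<close> is singular, take a left null vector \<open>y \<noteq> 0\<close> and let \<open>D\<close> carry the signs of \<open>y B\<close>.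
  Then \<open>y (A x + B D \<bar>C x\<bar>) = \<bar>y B\<bar> \<bar>C x\<bar> - (y B) T (C x) \<ge> 0\<close> for all \<open>x\<close>, and the system of (ii)
  has no solution for \<open>b = -y\<close>.
\<close>

section \<open>Diagonal matrices\<close>

definition diag_mat :: "real ^ 'k \<Rightarrow> real ^ 'k ^ 'k"
  where "diag_mat t = (\<chi> i j. if i = j then t $ i else 0)"

lemma diag_mat_mult_vec: "diag_mat t *v u = t * u"
  by (simp add: vec_eq_iff diag_mat_def matrix_vector_mult_def if_distrib[where f = "\<lambda>a. a * _"]
      cong: if_cong)

lemma abs_diag_mat_eq_mat_1:
  assumes "\<And>i. \<bar>t $ i\<bar> = 1"
  shows "\<bar>diag_mat t\<bar> = mat 1"
  using assms by (simp add: vec_eq_iff diag_mat_def mat_def abs_matrix_entry)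

lemma abs_eq_mat_1_imp_diag_mat:
  fixes D :: "real ^ 'k ^ 'k"
  assumes "\<bar>D\<bar> = mat 1"
  obtains s where "D = diag_mat s" "\<And>i. \<bar>s $ i\<bar> = 1"
proof
  have entry: "\<bar>D $ i $ j\<bar> = (if i = j then 1 else 0)" for i j
    using assms abs_matrix_entry[of D i j] by (simp add: mat_def)
  show "D = diag_mat (\<chi> i. D $ i $ i)"
    using entry by (auto simp: vec_eq_iff diag_mat_def) (metis abs_eq_0)
  show "\<bar>(\<chi> i. D $ i $ i) $ i\<bar> = 1" for i
    using entry[of i i] by simp
qed

section \<open>Regularity over all diagonal matrices with entries in the unit interval\<close>

text \<open>Injectivity of the square matrix \<open>A + B T C\<close> is its nonsingularity; \<open>t\<close> is the diagonal
  of \<open>T\<close>, and products of vectors are entrywise.\<close>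

definition diagonal_regular :: "real ^ 'n ^ 'n \<Rightarrow> real ^ 'k ^ 'n \<Rightarrow> real ^ 'n ^ 'k \<Rightarrow> bool"
  where "diagonal_regular A B C \<longleftrightarrow>
    (\<forall>t x. (\<forall>j. \<bar>t $ j\<bar> \<le> 1) \<longrightarrow> A *v x + B *v (t * (C *v x)) = 0 \<longrightarrow> x = 0)"

lemma diagonal_regular_mult_sign:
  fixes B :: "real ^ 'k ^ 'n"
  assumes "diagonal_regular A B C" and "\<bar>D\<bar> = mat 1"
  shows "diagonal_regular A (B ** D) C"
proof -
  obtain s where D: "D = diag_mat s" and s: "\<And>i. \<bar>s $ i\<bar> = 1"
    using abs_eq_mat_1_imp_diag_mat[OF assms(2)] by blast
  have "x = 0" if t: "\<forall>j. \<bar>t $ j\<bar> \<le> 1"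
    and x: "A *v x + (B ** D) *v (t * (C *v x)) = 0" for t x
  proof -
    have "(B ** D) *v (t * (C *v x)) = B *v ((s * t) * (C *v x))"
      by (simp add: D diag_mat_mult_vec mult.assoc flip: matrix_vector_mul_assoc)
    moreover have "\<forall>j. \<bar>(s * t) $ j\<bar> \<le> 1"
      using t s by (simp add: abs_mult)
    ultimately show "x = 0"
      using assms(1) x unfolding diagonal_regular_def by metis
  qed
  then show ?thesis
    unfolding diagonal_regular_def by blast
qed

lemma continuous_on_matrix_vector_mult:
  fixes M :: "real ^ 'n ^ 'm"
  shows "continuous_on S f \<Longrightarrow> continuous_on S (\<lambda>x. M *v f x)"
  by (rule bounded_linear.continuous_on[OF matrix_vector_mul_bounded_linear])

text \<open>The unit sphere times the set of admissible diagonals is compact, so the positive continuous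
  function \<open>norm ((A + B T C) x)\<close> has a positive minimum there; scaling does the rest.\<close>

lemma diagonal_regular_bounded_below:
  fixes A :: "real ^ 'n ^ 'n" and B :: "real ^ 'k ^ 'n" and C :: "real ^ 'n ^ 'k"
  assumes "diagonal_regular A B C"
  obtains c where "c > 0"
    "\<And>t x. (\<forall>j. \<bar>t $ j\<bar> \<le> 1) \<Longrightarrow> c * norm x \<le> norm (A *v x + B *v (t * (C *v x)))"
proof -
  define K where "K = {t :: real ^ 'k. \<forall>j. \<bar>t $ j\<bar> \<le> 1}"
  define S where "S = sphere (0 :: real ^ 'n) 1"
  define g where "g = (\<lambda>(t, x). norm (A *v x + B *v (t * (C *v x))))"
  have "K = cbox (\<chi> j. -1) (\<chi> j. 1)"
    by (auto simp: K_def mem_box_cart abs_le_iff minus_le_iff)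
  then have "compact (K \<times> S)"
    by (simp add: S_def compact_Times)
  moreover have "K \<times> S \<noteq> {}"
  proof -
    have "0 \<in> K" "S \<noteq> {}"
      by (simp_all add: K_def S_def)
    then show ?thesis by blast
  qed
  moreover have "continuous_on (K \<times> S) g"
    unfolding g_def case_prod_unfold times_vec_def
    by (intro continuous_intros continuous_on_matrix_vector_mult)
  ultimately obtain p where p: "p \<in> K \<times> S" and min: "\<And>q. q \<in> K \<times> S \<Longrightarrow> g p \<le> g q"
    using continuous_attains_inf[of "K \<times> S" g] by blast
  have pos: "g p > 0"
  proof -
    have "\<forall>j. \<bar>fst p $ j\<bar> \<le> 1" "snd p \<noteq> 0"
      using p by (auto simp: K_def S_def)
    then show ?thesis
      using assms unfolding diagonal_regular_def g_def case_prod_unfold zero_less_norm_iff by blast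
  qed
  have "g p * norm x \<le> norm (A *v x + B *v (t * (C *v x)))" if t: "\<forall>j. \<bar>t $ j\<bar> \<le> 1" for t x
  proof (cases "x = 0")
    case False
    define e where "e = x /\<^sub>R norm x"
    have x: "x = norm x *\<^sub>R e"
      using False by (simp add: e_def)
    have "(t, e) \<in> K \<times> S"
      using t False by (simp add: K_def S_def e_def)
    then have "g p \<le> g (t, e)"
      by (rule min)
    moreover have "A *v x + B *v (t * (C *v x)) = norm x *\<^sub>R (A *v e + B *v (t * (C *v e)))"
    proof -
      have "t * (r *\<^sub>R v) = r *\<^sub>R (t * v)" for r and v :: "real ^ 'k"
        by (simp add: vec_eq_iff)
      then show ?thesis
        by (subst (1 2) x) (simp only: matrix_vector_mult_scaleR scaleR_right_distrib)
    qed
    ultimately show ?thesis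
      by (simp add: g_def mult.commute mult_left_mono)
  qed simp
  with pos that show ?thesis by blast
qed

section \<open>Unique solvability\<close>

text \<open>The entries of \<open>t\<close> are difference quotients of the absolute value, which is 1-Lipschitz.
  Where \<open>u\<close> and \<open>v\<close> agree, the quotient defaults to 0, as it may.\<close>

lemma abs_diff_eq_times_diff:
  fixes u v :: "real ^ 'k"
  obtains t where "\<forall>j. \<bar>t $ j\<bar> \<le> 1" "\<bar>u\<bar> - \<bar>v\<bar> = t * (u - v)"
proof
  let ?t = "\<chi> j. (\<bar>u $ j\<bar> - \<bar>v $ j\<bar>) / (u $ j - v $ j)"
  show "\<forall>j. \<bar>?t $ j\<bar> \<le> 1"
    by (simp add: abs_triangle_ineq3 divide_le_eq_1)
  show "\<bar>u\<bar> - \<bar>v\<bar> = ?t * (u - v)"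
    by (simp add: vec_eq_iff abs_vec_entry)
qed

text \<open>As \<open>u\<close> moves along the line, \<open>\<bar>u\<bar> - \<bar>u - w\<bar>\<close> takes all values between \<open>- \<bar>w\<bar>\<close> and \<open>\<bar>w\<bar>\<close>.
  The witness lies between \<open>0\<close> and \<open>w\<close>, at a point that splits this segment in
  the required proportion.\<close>

lemma times_eq_abs_diff:
  fixes t w :: "real ^ 'k"
  assumes "\<forall>j. \<bar>t $ j\<bar> \<le> 1"
  obtains u where "\<bar>u\<bar> - \<bar>u - w\<bar> = t * w"
proof
  let ?u = "\<chi> j. if w $ j \<ge> 0 then (1 + t $ j) / 2 * w $ j else (1 - t $ j) / 2 * w $ j"
  have pos: "\<bar>(1 + s) / 2 * r\<bar> - \<bar>(1 + s) / 2 * r - r\<bar> = s * \<bar>r\<bar>" if "\<bar>s\<bar> \<le> 1" for s r :: real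
  proof -
    have "(1 + s) / 2 * r - r = - ((1 - s) / 2 * r)"
      by (simp add: field_simps)
    then have "\<bar>(1 + s) / 2 * r\<bar> - \<bar>(1 + s) / 2 * r - r\<bar> = (1 + s) / 2 * \<bar>r\<bar> - (1 - s) / 2 * \<bar>r\<bar>"
      using that by (simp only: abs_minus_cancel abs_mult) (simp add: abs_le_iff)
    then show ?thesis
      by (simp add: field_simps)
  qed
  show "\<bar>?u\<bar> - \<bar>?u - w\<bar> = t * w"
    unfolding vec_eq_iff
  proof
    fix j
    show "(\<bar>?u\<bar> - \<bar>?u - w\<bar>) $ j = (t * w) $ j"
      using assms pos[of "t $ j" "w $ j"] pos[of "- (t $ j)" "w $ j"]
      by (cases "w $ j \<ge> 0") (simp_all only: vector_minus_component vector_mult_component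
          abs_vec_entry vec_lambda_beta if_True if_False abs_minus_cancel, simp_all)
  qed
qed

text \<open>The lower bound makes preimages of Cauchy sequences Cauchy, so the image is closed; it is open
  by invariance of domain, and the space is connected.\<close>

lemma expanding_continuous_surj:
  fixes f :: "'a :: euclidean_space \<Rightarrow> 'a"
  assumes cont: "continuous_on UNIV f" and "c > 0"
    and expand: "\<And>x y. c * dist x y \<le> dist (f x) (f y)"
  shows "surj f"
proof -
  have "inj f"
  proof (rule injI)
    fix x y assume "f x = f y"
    then show "x = y"
      using expand[of x y] \<open>c > 0\<close> by (simp add: mult_le_0_iff)
  qed
  then have "open (range f)"
    using invariance_of_domain[OF cont open_UNIV] by blast
  moreover have "closed (range f)"
    unfolding closed_sequential_limits
  proof clarify
    fix s l assume "\<forall>n. s n \<in> range f" and lim: "s \<longlonglongrightarrow> l"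
    then have "\<forall>n. \<exists>z. s n = f z"
      by blast
    then obtain z where z: "\<And>n. s n = f (z n)"
      by metis
    have "Cauchy z"
    proof (rule metric_CauchyI)
      fix e :: real assume "e > 0"
      then have "c * e > 0" using \<open>c > 0\<close> by simp
      then obtain N where N: "\<forall>m\<ge>N. \<forall>n\<ge>N. dist (s m) (s n) < c * e"
        using metric_CauchyD[OF LIMSEQ_imp_Cauchy[OF lim]] by blast
      have "dist (z m) (z n) < e" if "m \<ge> N" "n \<ge> N" for m n
      proof -
        have "c * dist (z m) (z n) < c * e"
          using expand[of "z m" "z n"] N that unfolding z by (blast intro: order.strict_trans1)
        then show ?thesis using \<open>c > 0\<close> by simp
      qed
      then show "\<exists>N. \<forall>m\<ge>N. \<forall>n\<ge>N. dist (z m) (z n) < e" by blast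
    qed
    then obtain a where "z \<longlonglongrightarrow> a"
      unfolding Cauchy_convergent_iff convergent_def by blast
    then have "(\<lambda>n. f (z n)) \<longlonglongrightarrow> f a"
      using continuous_on_tendsto_compose[OF cont] by simp
    then have "l = f a"
      using LIMSEQ_unique[OF lim] by (simp flip: z)
    then show "l \<in> range f" by simp
  qed
  ultimately show ?thesis
    using clopen by blast
qed

lemma diagonal_regular_imp_unique_solution:
  fixes A :: "real ^ 'n ^ 'n" and B :: "real ^ 'k ^ 'n" and C :: "real ^ 'n ^ 'k"
  assumes "diagonal_regular A B C"
  shows "\<exists>!x. A *v x + B *v \<bar>C *v x - d\<bar> = b"
proof -
  define f where "f = (\<lambda>x. A *v x + B *v \<bar>C *v x - d\<bar>)"
  obtain c where c: "c > 0"
    "\<And>t x. (\<forall>j. \<bar>t $ j\<bar> \<le> 1) \<Longrightarrow> c * norm x \<le> norm (A *v x + B *v (t * (C *v x)))"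
    using diagonal_regular_bounded_below[OF assms] by blast
  have expand: "c * dist x y \<le> dist (f x) (f y)" for x y
  proof -
    obtain t where t: "\<forall>j. \<bar>t $ j\<bar> \<le> 1"
      "\<bar>C *v x - d\<bar> - \<bar>C *v y - d\<bar> = t * ((C *v x - d) - (C *v y - d))"
      by (rule abs_diff_eq_times_diff)
    have "f x - f y = A *v (x - y) + B *v (\<bar>C *v x - d\<bar> - \<bar>C *v y - d\<bar>)"
      by (simp add: f_def matrix_vector_mult_diff_distrib)
    also have "\<dots> = A *v (x - y) + B *v (t * (C *v (x - y)))"
      by (simp add: t(2) matrix_vector_mult_diff_distrib)
    finally show ?thesis
      using c(2)[OF t(1), of "x - y"] by (simp add: dist_norm)
  qed
  have "continuous_on UNIV f"
    unfolding f_def abs_vec_def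
    by (intro continuous_intros continuous_on_matrix_vector_mult)
  then have "surj f"
    using expanding_continuous_surj c(1) expand by blast
  then obtain x where "f x = b"
    by (metis surjD)
  moreover have "y = x" if "f y = b" for y
    using expand[of y x] c(1) that \<open>f x = b\<close> by (simp add: mult_le_0_iff)
  ultimately show ?thesis
    unfolding f_def by blast
qed

text \<open>A null vector \<open>x\<close> of \<open>A + B T C\<close> becomes the difference of the two solutions \<open>x\<close> and \<open>0\<close>
  once \<open>d\<close> is chosen so that the corresponding absolute values differ by \<open>T C x\<close>.\<close>

lemma unique_solution_imp_diagonal_regular:
  fixes A :: "real ^ 'n ^ 'n" and B :: "real ^ 'k ^ 'n" and C :: "real ^ 'n ^ 'k"
  assumes unique: "\<And>b d. \<exists>!x. A *v x + B *v \<bar>C *v x - d\<bar> = b"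
  shows "diagonal_regular A B C"
  unfolding diagonal_regular_def
proof (intro allI impI)
  fix t x assume t: "\<forall>j. \<bar>t $ j\<bar> \<le> 1" and x: "A *v x + B *v (t * (C *v x)) = 0"
  obtain u where u: "\<bar>u\<bar> - \<bar>u - C *v x\<bar> = t * (C *v x)"
    using times_eq_abs_diff[OF t] by blast
  define d where "d = C *v x - u"
  have "A *v x + B *v (\<bar>u\<bar> - \<bar>u - C *v x\<bar>) = 0"
    using x u by simp
  then have "A *v x + B *v \<bar>C *v x - d\<bar> = A *v 0 + B *v \<bar>C *v 0 - d\<bar>"
    by (simp add: d_def matrix_vector_mult_diff_distrib algebra_simps)
  then show "x = 0"
    using unique by blast
qed

section \<open>Solvability for all sign matrices\<close>

lemma singular_imp_left_null_vector:
  fixes M :: "real ^ 'n ^ 'n"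
  assumes "M *v x = 0" "x \<noteq> 0"
  obtains y where "y v* M = 0" "y \<noteq> 0"
proof -
  have "\<not> invertible M"
    using assms by (metis invertible_left_inverse matrix_left_invertible_ker)
  then have "\<not> invertible (transpose M)"
    using transpose_invertible by fastforce
  then show ?thesis
    using that by (metis invertible_left_inverse matrix_left_invertible_ker transpose_matrix_vector)
qed

text \<open>Against a left null vector \<open>y\<close> of a singular \<open>A + B T C\<close>, the signs of \<open>y B\<close> confine the range
  of the system to a half-space: \<open>y \<bullet> (A x + B D \<bar>C x\<bar>)\<close> is a sum of terms
  \<open>\<bar>w j\<bar> \<bar>z j\<bar> - t j w j z j \<ge> 0\<close> with \<open>w = y B\<close> and \<open>z = C x\<close>.\<close>

lemma sign_solvable_imp_diagonal_regular:
  fixes A :: "real ^ 'n ^ 'n" and B :: "real ^ 'k ^ 'n" and C :: "real ^ 'n ^ 'k"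
  assumes solvable: "\<And>b D. \<bar>D\<bar> = mat 1 \<Longrightarrow> \<exists>x. A *v x + (B ** D) *v \<bar>C *v x\<bar> = b"
  shows "diagonal_regular A B C"
  unfolding diagonal_regular_def
proof (intro allI impI, rule ccontr)
  fix t x0 assume t: "\<forall>j. \<bar>t $ j\<bar> \<le> 1"
    and x0: "A *v x0 + B *v (t * (C *v x0)) = 0" "x0 \<noteq> 0"
  define M where "M = A + B ** diag_mat t ** C"
  have M: "M *v x = A *v x + B *v (t * (C *v x))" for x
    by (simp add: M_def matrix_vector_mult_add_rdistrib diag_mat_mult_vec
        flip: matrix_vector_mul_assoc)
  obtain y where y: "y v* M = 0" "y \<noteq> 0"
    using singular_imp_left_null_vector[of M x0] x0 M by auto
  define w where "w = y v* B"
  define s where "s = (\<chi> j. if w $ j \<ge> 0 then 1 else (-1 :: real))"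
  have "\<bar>diag_mat s\<bar> = mat 1"
    by (rule abs_diag_mat_eq_mat_1) (simp add: s_def)
  then obtain x where x: "A *v x + (B ** diag_mat s) *v \<bar>C *v x\<bar> = - y"
    using solvable by blast
  define z where "z = C *v x"
  have "A *v x + B *v (t * z) = M *v x"
    by (simp add: M z_def)
  then have "y \<bullet> (A *v x) + w \<bullet> (t * z) = 0"
    using y(1) by (simp add: w_def dot_lmul_matrix flip: inner_add_right)
      (simp flip: dot_lmul_matrix)
  moreover have "y \<bullet> (A *v x) + w \<bullet> (s * \<bar>z\<bar>) = - (y \<bullet> y)"
    using arg_cong[OF x, of "(\<bullet>) y"]
    by (simp add: w_def z_def dot_lmul_matrix inner_add_right diag_mat_mult_vec
        flip: matrix_vector_mul_assoc)
  moreover have "w \<bullet> (t * z) \<le> w \<bullet> (s * \<bar>z\<bar>)"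
    unfolding inner_vec_def
  proof (rule sum_mono)
    fix j
    have "t $ j * (w $ j * z $ j) \<le> \<bar>t $ j\<bar> * \<bar>w $ j * z $ j\<bar>"
      by (metis abs_ge_self abs_mult)
    also have "\<dots> \<le> \<bar>w $ j\<bar> * \<bar>z $ j\<bar>"
      using t by (simp add: abs_mult mult_left_le_one_le)
    finally show "w $ j \<bullet> (t * z) $ j \<le> w $ j \<bullet> (s * \<bar>z\<bar>) $ j"
      by (auto simp: s_def abs_vec_entry algebra_simps)
  qed
  moreover have "y \<bullet> y > 0"
    using y(2) by simp
  ultimately show False
    by linarith
qed

theorem theorem9:
  fixes A :: "real ^ 'n ^ 'n" and B :: "real ^ 'k ^ 'n" and C :: "real ^ 'n ^ 'k"
  shows "(\<forall>(b :: real ^ 'n) (d :: real ^ 'k). \<exists>!x :: real ^ 'n. A *v x + B *v \<bar>C *v x - d\<bar> = b)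
    \<longleftrightarrow> (\<forall>(b :: real ^ 'n) (D :: real ^ 'k ^ 'k). \<bar>D\<bar> = mat 1 \<longrightarrow>
          (\<exists>x :: real ^ 'n. A *v x + (B ** D) *v \<bar>C *v x\<bar> = b))"
  (is "?unique \<longleftrightarrow> ?solvable")
proof
  assume ?unique
  then have regular: "diagonal_regular A B C"
    using unique_solution_imp_diagonal_regular by blast
  show ?solvable
  proof (intro allI impI)
    fix b and D :: "real ^ 'k ^ 'k" assume "\<bar>D\<bar> = mat 1"
    with regular have "diagonal_regular A (B ** D) C"
      by (rule diagonal_regular_mult_sign)
    from diagonal_regular_imp_unique_solution[OF this, of 0 b]
    show "\<exists>x. A *v x + (B ** D) *v \<bar>C *v x\<bar> = b"
      by auto
  qed
next
  assume ?solvable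
  then have "diagonal_regular A B C"
    using sign_solvable_imp_diagonal_regular by blast
  then show ?unique
    using diagonal_regular_imp_unique_solution by blast
qed

end
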